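(* Let $m,n\ge 0$ be integers and let $T_{m,n}$ be the square torus grid of dimension $(4m+2)\times(4n+2)$, i.e. the set of cells $\mathbb{Z}/(4m+2)\mathbb{Z}\times\mathbb{Z}/(4n+2)\mathbb{Z}$. Then $T_{m,n}$ cannot be tiled by X-hexominoes.
   Context: The X-hexomino is the polyomino $\{(0,0),(0,1),(0,2),(0,3),(1,1),(-1,1)\}\subset\mathbb{Z}^2$ (a row of four unit squares together with one square directly above and one square directly below the second square of the row). A placement of a polyomino $P\subset\mathbb{Z}^2$ on the torus grid is the image of $g(P)+v$ under the reduction map $\mathbb{Z}^2\to\mathbb{Z}/(4m+2)\mathbb{Z}\times\mathbb{Z}/(4n+2)\mathbb{Z}$, where $g$ is a rotation or reflection of the square lattice (an element of the dihedral group of order 8 acting on $\mathbb{Z}^2$) and $v\in\mathbb{Z}^2$, provided that this image consists of $|P|$ distinct cells. A tiling of the torus grid by a polyomino is a collection of placements of that polyomino whose cell sets partition the set of all cells. *)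

theory Defs
  imports Main "HOL-Library.Disjoint_Sets"
begin

type_synonym cell = "int \<times> int"

definition X_hexomino :: "cell set" where
  "X_hexomino = {(0,0), (0,1), (0,2), (0,3), (1,1), (-1,1)}"

definition dihedral_maps :: "(cell \<Rightarrow> cell) set" where
  "dihedral_maps =
    {\<lambda>(x,y). (x,y), \<lambda>(x,y). (-y,x), \<lambda>(x,y). (-x,-y), \<lambda>(x,y). (y,-x),
     \<lambda>(x,y). (x,-y), \<lambda>(x,y). (-x,y), \<lambda>(x,y). (y,x), \<lambda>(x,y). (-y,-x)}"

definition translate :: "cell \<Rightarrow> cell \<Rightarrow> cell" where
  "translate v c = (fst c + fst v, snd c + snd v)"

text \<open>
  For positive \<open>M\<close> and \<open>N\<close>, the residue classes in \<open>\<int>/M \<times> \<int>/N\<close> are represented by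
  their least non-negative representatives.
\<close>

definition torus_cells :: "nat \<Rightarrow> nat \<Rightarrow> cell set" where
  "torus_cells M N = {0..<int M} \<times> {0..<int N}"

definition torus_reduce :: "nat \<Rightarrow> nat \<Rightarrow> cell \<Rightarrow> cell" where
  "torus_reduce M N c = (fst c mod int M, snd c mod int N)"

definition is_placement :: "nat \<Rightarrow> nat \<Rightarrow> cell set \<Rightarrow> cell set \<Rightarrow> bool" where
  "is_placement M N P S \<longleftrightarrow>
    (\<exists>g\<in>dihedral_maps. \<exists>v. S = torus_reduce M N ` translate v ` g ` P \<and> card S = card P)"

definition is_torus_tiling :: "nat \<Rightarrow> nat \<Rightarrow> cell set \<Rightarrow> cell set set \<Rightarrow> bool" where
  "is_torus_tiling M N P \<T> \<longleftrightarrow>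
    (\<forall>S\<in>\<T>. is_placement M N P S) \<and> partition_on (torus_cells M N) \<T>"

end

theory Submission
  imports Defs
begin

text \<open>
  Split the cells into four classes according to the parities of their coordinates; this is
  well defined on a torus with even side lengths. An X-hexomino meets every class in zero or two
  cells, whereas the class of cells with both coordinates even consists of \<open>(2m+1)(2n+1)\<close>
  cells, which is an odd number.
\<close>

definition even_cells :: "cell set" where
  "even_cells = {c. even (fst c) \<and> even (snd c)}"

lemma torus_reduce_in_even_cells_iff:
  assumes "even M" "even N"
  shows "torus_reduce M N c \<in> even_cells \<longleftrightarrow> c \<in> even_cells"
  using assms by (simp add: even_cells_def torus_reduce_def dvd_mod_iff)

text \<open>The six cells pair up modulo 2: (0,0) with (0,2), (0,1) with (0,3), (1,1) with (-1,1).
  Every \<open>g\<close> and every translation preserves congruence modulo 2, so both cells of a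
  pair land in \<open>even_cells\<close> or neither does.\<close>

lemma even_card_dihedral_X_hexomino_even_cells:
  assumes "g \<in> dihedral_maps"
  shows "even (card {p \<in> X_hexomino. translate v (g p) \<in> even_cells})"
proof -
  have "card {p \<in> X_hexomino. translate v (g p) \<in> even_cells}
      = (\<Sum>p\<in>X_hexomino. if translate v (g p) \<in> even_cells then 1 else 0)"
    \<comment> \<open>\<open>sum.insert\<close> is withheld so that the sum stays whole until
      \<open>sum.If_cases\<close> turns it into a cardinality.\<close>
    by (simp add: X_hexomino_def sum.If_cases Int_def del: sum.insert)
  also have "even \<dots>"
    using assms unfolding dihedral_maps_def
    \<comment> \<open>Only the parities of \<open>v\<close> matter, which leaves 8 maps times 4
      cases.\<close>
    by (elim insertE emptyE; cases "even (fst v)"; cases "even (snd v)")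
       (simp_all add: X_hexomino_def translate_def even_cells_def)
  finally show ?thesis .
qed

lemma even_card_placement_even_cells:
  assumes "even M" "even N" and placement: "is_placement M N X_hexomino S"
  shows "even (card (S \<inter> even_cells))"
proof -
  obtain g v where g: "g \<in> dihedral_maps"
    and S: "S = torus_reduce M N ` translate v ` g ` X_hexomino"
    and card_S: "card S = card X_hexomino"
    using placement unfolding is_placement_def by blast
  define f where "f p = torus_reduce M N (translate v (g p))" for p
  have S_f: "S = f ` X_hexomino"
    unfolding S f_def by (simp add: image_image)
  have "finite X_hexomino"
    by (simp add: X_hexomino_def)
  \<comment> \<open>The cardinality condition on a placement says that wrapping around the torus
    identifies no two cells, so the count before reduction carries over to \<open>S\<close>.\<close>
  then have inj: "inj_on f X_hexomino"
    using card_S unfolding S_f by (rule eq_card_imp_inj_on)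
  have "S \<inter> even_cells = f ` {p \<in> X_hexomino. translate v (g p) \<in> even_cells}"
    unfolding S_f f_def using torus_reduce_in_even_cells_iff[OF assms(1,2)] by blast
  moreover have "inj_on f {p \<in> X_hexomino. translate v (g p) \<in> even_cells}"
    using inj by (rule inj_on_subset) auto
  ultimately show ?thesis
    using even_card_dihedral_X_hexomino_even_cells[OF g] by (simp add: card_image)
qed

text \<open>Halving both coordinates maps these cells bijectively onto an \<open>a\<close> by
  \<open>b\<close> box.\<close>

lemma card_torus_even_cells:
  "card (torus_cells (2 * a) (2 * b) \<inter> even_cells) = a * b"
proof -
  have "torus_cells (2 * a) (2 * b) \<inter> even_cells
      = (\<lambda>(x, y). (2 * x, 2 * y)) ` ({0..<int a} \<times> {0..<int b})"
    by (auto simp: torus_cells_def even_cells_def image_iff elim!: evenE)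
  moreover have "inj_on (\<lambda>(x, y). (2 * x, 2 * y)) ({0..<int a} \<times> {0..<int b})"
    by (auto simp: inj_on_def)
  ultimately show ?thesis
    by (simp add: card_image card_cartesian_product)
qed

theorem theorem3p3:
  fixes m n :: nat
  shows "\<not> (\<exists>\<T>. is_torus_tiling (4 * m + 2) (4 * n + 2) X_hexomino \<T>)"
proof
  let ?M = "4 * m + 2" and ?N = "4 * n + 2"
  assume "\<exists>\<T>. is_torus_tiling ?M ?N X_hexomino \<T>"
  then obtain \<T> where placement: "\<And>S. S \<in> \<T> \<Longrightarrow> is_placement ?M ?N X_hexomino S"
    and part: "partition_on (torus_cells ?M ?N) \<T>"
    unfolding is_torus_tiling_def by blast
  have fin: "finite (torus_cells ?M ?N)"
    by (simp add: torus_cells_def)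
  have cover: "torus_cells ?M ?N = \<Union>\<T>" and disj: "disjoint \<T>"
    using part by (auto simp: partition_on_def)
  have fin_\<T>: "finite \<T>" and fin_S: "\<And>S. S \<in> \<T> \<Longrightarrow> finite S"
    using fin unfolding cover by (auto dest: finite_UnionD intro: finite_subset)
  have "card (torus_cells ?M ?N \<inter> even_cells) = card (\<Union>S\<in>\<T>. S \<inter> even_cells)"
    unfolding cover by (rule arg_cong[where f = card]) auto
  also have "\<dots> = (\<Sum>S\<in>\<T>. card (S \<inter> even_cells))"
    using fin_\<T> fin_S disj by (intro card_UN_disjoint) (auto simp: disjoint_def)
  also have "even \<dots>"
    by (intro dvd_sum even_card_placement_even_cells[OF _ _ placement]) auto
  \<comment> \<open>Since \<open>4 * m + 2 = 2 * (2 * m + 1)\<close>, and likewise for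
    \<open>n\<close>, the total is a product of two odd numbers.\<close>
  finally have "even ((2 * m + 1) * (2 * n + 1))"
    using card_torus_even_cells[of "2 * m + 1" "2 * n + 1"] by simp
  then show False
    by simp
qed

end
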